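(* Let $\Gamma$ be a simple strongly connected digraph with vertex set $X$, adjacency matrix $A$, diameter $D$ and distance-$i$ matrices $A_0=I,A_1=A,\ldots,A_D$. Then $\Gamma$ is a distance-regular digraph if and only if at least one of the following holds. (i) $A^\top\in\{A_0,\ldots,A_D\}$ and there exist complex scalars $p^h_{ij}$ $(0\le i,j,h\le D)$ with $A_iA_j=\sum_{h=0}^D p^h_{ij}A_h$ for all $0\le i,j\le D$. (ii) $A_i^\top\in\{A_0,\ldots,A_D\}$ for all $0\le i\le D$, and $A_iA_j=\sum_{h=0}^D p^h_{ij}A_h$ $(0\le i,j\le D)$ for some scalars $p^h_{ij}$. (iii) $A^\top\in\{A_0,\ldots,A_D\}$ and there exist complex scalars $p^h_{ij}$ $(0\le i,j,h\le D)$ such that $|\Gamma^{\rightarrow}_i(x)\cap\Gamma^{\leftarrow}_j(y)|=p^h_{ij}$ for all $x\in X$ and $y\in\Gamma^{\rightarrow}_h(x)$.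
   Context: $\partial(x,y)$ is the directed distance; $\Gamma^{\rightarrow}_i(x)=\{z\mid\partial(x,z)=i\}$, $\Gamma^{\leftarrow}_i(x)=\{z\mid\partial(z,x)=i\}$; $(A_i)_{xy}=1$ iff $\partial(x,y)=i$. $\Gamma$ is a distance-regular digraph if there are integers $d^{\rightarrow}_{ij},d^{\leftarrow}_{ij}$ $(0\le i,j\le D)$ such that for every $x\in X$ and every $y\in\Gamma^{\rightarrow}_i(x)$: $|\Gamma^{\rightarrow}_1(y)\cap\Gamma^{\rightarrow}_j(x)|=d^{\rightarrow}_{ij}$ and $|\Gamma^{\leftarrow}_1(y)\cap\Gamma^{\rightarrow}_j(x)|=d^{\leftarrow}_{ij}$. *)

theory Defs
  imports "HOL-Analysis.Analysis" "Graph_Theory.Graph_Theory"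
begin

text \<open>
  A \<^emph>\<open>simple digraph\<close> is a \<^locale>\<open>digraph\<close>: finite, no loops, no parallel arcs. A pair of opposite
  arcs is allowed, so undirected graphs are included.

  The distance below is the usual one when \<open>y\<close> is reachable from \<open>x\<close>, and it is an unspecified
  number otherwise; everything in this theory is meant for strongly connected digraphs.
\<close>

definition ddist :: "('v, 'e) pre_digraph \<Rightarrow> 'v \<Rightarrow> 'v \<Rightarrow> nat" where
  "ddist G x y = (LEAST n. \<exists>p. pre_digraph.awalk G x p y \<and> length p = n)"

definition ddiameter :: "('v, 'e) pre_digraph \<Rightarrow> nat" where
  "ddiameter G = Max {ddist G x y | x y. x \<in> verts G \<and> y \<in> verts G}"

definition out_sphere :: "('v, 'e) pre_digraph \<Rightarrow> nat \<Rightarrow> 'v \<Rightarrow> 'v set" where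
  "out_sphere G i x = {z \<in> verts G. ddist G x z = i}"

definition in_sphere :: "('v, 'e) pre_digraph \<Rightarrow> nat \<Rightarrow> 'v \<Rightarrow> 'v set" where
  "in_sphere G i x = {z \<in> verts G. ddist G z x = i}"

definition distance_regular_digraph :: "('v, 'e) pre_digraph \<Rightarrow> bool" where
  "distance_regular_digraph G \<longleftrightarrow>
     (\<exists>dout din :: nat \<Rightarrow> nat \<Rightarrow> int.
        \<forall>i\<le>ddiameter G. \<forall>j\<le>ddiameter G. \<forall>x\<in>verts G. \<forall>y\<in>out_sphere G i x.
          int (card (out_sphere G 1 y \<inter> out_sphere G j x)) = dout i j \<and>
          int (card (in_sphere G 1 y \<inter> out_sphere G j x)) = din i j)"

text \<open>
  Matrices are indexed by the vertex type; they describe \<open>G\<close> faithfully when \<open>verts G = UNIV\<close>.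
\<close>

definition adjacency_matrix :: "('v::finite, 'e) pre_digraph \<Rightarrow> complex^'v^'v" where
  "adjacency_matrix G = (\<chi> x y. if x \<rightarrow>\<^bsub>G\<^esub> y then 1 else 0)"

definition distance_matrix :: "('v::finite, 'e) pre_digraph \<Rightarrow> nat \<Rightarrow> complex^'v^'v" where
  "distance_matrix G i = (\<chi> x y. if ddist G x y = i then 1 else 0)"

definition matrix_scale :: "complex \<Rightarrow> complex^'n^'m \<Rightarrow> complex^'n^'m" (infixr \<open>*\<^sub>M\<close> 75) where
  "c *\<^sub>M M = (\<chi> x y. c * M $ x $ y)"

lemma ddist_eq_0_iff:
  assumes "strongly_connected G" "wf_digraph G" "x \<in> verts G" "y \<in> verts G"
  shows "ddist G x y = 0 \<longleftrightarrow> x = y"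
proof -
  interpret wf_digraph G by fact
  have "x \<rightarrow>\<^sup>*\<^bsub>G\<^esub> y" using assms by (auto simp: strongly_connected_def)
  then have "\<exists>n p. awalk x p y \<and> length p = n" by (auto simp: reachable_awalk)
  then have "\<exists>p. awalk x p y \<and> length p = ddist G x y"
    unfolding ddist_def by (rule LeastI_ex)
  moreover have "ddist G x y = 0" if "x = y"
    unfolding ddist_def using assms(3) that by (intro Least_eq_0) (auto simp: awalk_Nil_iff)
  ultimately show ?thesis by (auto simp: awalk_Nil_iff)
qed

lemma ddist_eq_1_iff:
  assumes "strongly_connected G" "loopfree_digraph G" "x \<in> verts G" "y \<in> verts G"
  shows "ddist G x y = 1 \<longleftrightarrow> x \<rightarrow>\<^bsub>G\<^esub> y"
proof -
  interpret loopfree_digraph G by fact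
  have "x \<rightarrow>\<^sup>*\<^bsub>G\<^esub> y" using assms by (auto simp: strongly_connected_def)
  then have "\<exists>n p. awalk x p y \<and> length p = n" by (auto simp: reachable_awalk)
  then have ex: "\<exists>p. awalk x p y \<and> length p = ddist G x y"
    unfolding ddist_def by (rule LeastI_ex)
  show ?thesis
  proof
    assume "ddist G x y = 1"
    with ex obtain p where "awalk x p y" "length p = Suc 0" by auto
    then obtain e where "awalk x [e] y" by (auto simp: length_Suc_conv)
    then show "x \<rightarrow>\<^bsub>G\<^esub> y" by (auto simp: awalk_Cons_iff awalk_Nil_iff arcs_ends_conv)
  next
    assume "x \<rightarrow>\<^bsub>G\<^esub> y"
    then obtain e where e: "e \<in> arcs G" "tail G e = x" "head G e = y"
      by (auto simp: arcs_ends_conv)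
    then have "awalk x [e] y" by (auto simp: awalk_Cons_iff awalk_Nil_iff)
    then have "ddist G x y \<le> 1"
      unfolding ddist_def by (intro Least_le) (rule exI[of _ "[e]"], simp)
    moreover have "ddist G x y \<noteq> 0"
      using e no_loops ddist_eq_0_iff[OF assms(1) wf_digraph assms(3,4)] by auto
    ultimately show "ddist G x y = 1" by simp
  qed
qed

lemma distance_matrix_0:
  assumes "strongly_connected G" "wf_digraph G" "verts G = UNIV"
  shows "distance_matrix G 0 = mat 1"
  using assms by (simp add: distance_matrix_def mat_def ddist_eq_0_iff)

lemma distance_matrix_1:
  assumes "strongly_connected G" "loopfree_digraph G" "verts G = UNIV"
  shows "distance_matrix G 1 = adjacency_matrix G"
  using assms ddist_eq_1_iff[OF assms(1,2)]
  by (simp add: distance_matrix_def adjacency_matrix_def)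

end

theory Submission
  imports Defs
begin

text \<open>
  Since every distance is at most \<open>D\<close>, the span of \<open>A\<^sub>0, \<dots>, A\<^sub>D\<close> consists of the matrices whose
  entries depend only on the distance, and \<open>G\<close> is distance-regular iff all \<open>A\<^sub>j A\<close> and
  \<open>A\<^sub>j A\<^sup>T\<close> lie in this span, that is, iff the span is closed under right multiplication by \<open>A\<close>
  and \<open>A\<^sup>T\<close>. The coefficient of \<open>A\<^sub>j\<^sub>+\<^sub>1\<close> in \<open>A\<^sub>j A\<close> is nonzero and
  those of the later matrices vanish, so every \<open>A\<^sub>i\<close> is a polynomial in \<open>A\<close> and the span is closed
  under multiplication by every \<open>A\<^sub>i\<close> and \<open>A\<^sub>i\<^sup>T\<close>. In particular \<open>A\<^sub>i\<^sup>T\<close> lies in the span, so the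
  distance from \<open>y\<close> to \<open>x\<close> is a function of the distance from \<open>x\<close> to \<open>y\<close>; this function is an
  involution and \<open>A\<^sub>i\<^sup>T\<close> is a single distance matrix.
\<close>

section \<open>Matrices whose entries depend only on the distance\<close>

text \<open>The function \<open>c\<close> lives on all of \<open>nat\<close>, so neither the
  diameter nor a finite sum is mentioned; \<open>distance_expansion_iff\<close> below identifies
  this with membership in the span.\<close>

definition distance_invariant :: "('v::finite, 'e) pre_digraph \<Rightarrow> complex^'v^'v \<Rightarrow> bool" where
  "distance_invariant G M \<longleftrightarrow> (\<exists>c. \<forall>x y. M $ x $ y = c (ddist G x y))"

lemma distance_invariant_add:
  assumes "distance_invariant G M" "distance_invariant G N"
  shows "distance_invariant G (M + N)"
proof -
  from assms obtain c d where "\<forall>x y. M $ x $ y = c (ddist G x y)" "\<forall>x y. N $ x $ y = d (ddist G x y)"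
    by (auto simp: distance_invariant_def)
  then show ?thesis
    unfolding distance_invariant_def by (intro exI[of _ "\<lambda>h. c h + d h"]) simp
qed

lemma distance_invariant_scale:
  assumes "distance_invariant G M"
  shows "distance_invariant G (a *\<^sub>M M)"
proof -
  from assms obtain c where "\<forall>x y. M $ x $ y = c (ddist G x y)"
    by (auto simp: distance_invariant_def)
  then show ?thesis
    unfolding distance_invariant_def by (intro exI[of _ "\<lambda>h. a * c h"]) (simp add: matrix_scale_def)
qed

lemma distance_invariant_sum:
  assumes "finite S" "\<And>h. h \<in> S \<Longrightarrow> distance_invariant G (M h)"
  shows "distance_invariant G (\<Sum>h\<in>S. M h)"
  using assms
proof (induction S rule: finite_induct)
  case empty
  then show ?case by (auto simp: distance_invariant_def)
next
  case (insert h S)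
  then show ?case by (simp add: distance_invariant_add)
qed

lemma distance_invariant_distance_matrix: "distance_invariant G (distance_matrix G i)"
  unfolding distance_invariant_def distance_matrix_def
  by (intro exI[of _ "\<lambda>h. if h = i then 1 else 0"]) simp

lemma matrix_mult_scale_right: "M ** (c *\<^sub>M N) = c *\<^sub>M (M ** N)"
  by (simp add: matrix_matrix_mult_def matrix_scale_def vec_eq_iff sum_distrib_left mult_ac)

lemma matrix_mult_scale_left: "(c *\<^sub>M M) ** N = c *\<^sub>M (M ** N)"
  by (simp add: matrix_matrix_mult_def matrix_scale_def vec_eq_iff sum_distrib_left mult_ac)

lemma transpose_scale: "transpose (c *\<^sub>M M) = c *\<^sub>M transpose M"
  by (simp add: transpose_def matrix_scale_def vec_eq_iff)

lemma transpose_add: "transpose (M + N) = transpose M + transpose N"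
  by (simp add: transpose_def vec_eq_iff)

lemma sum_matrix_mult: "(\<Sum>h\<in>S. M h) ** N = (\<Sum>h\<in>S. M h ** N)"
  by (induction S rule: infinite_finite_induct) (simp_all add: matrix_matrix_mult_def vec_eq_iff ring_distribs sum.distrib)

section \<open>Shortest walks and the diameter\<close>

context
  fixes G :: "('v::finite, 'e) pre_digraph"
  assumes simple: "digraph G"
    and strong: "strongly_connected G"
    and vertices: "verts G = UNIV"
begin

interpretation digraph G by (rule simple)

lemma ex_awalk_ddist: "\<exists>p. awalk x p y \<and> length p = ddist G x y"
proof -
  have "x \<rightarrow>\<^sup>*\<^bsub>G\<^esub> y" using strong vertices by (auto simp: strongly_connected_def)
  then have "\<exists>n p. awalk x p y \<and> length p = n" by (auto simp: reachable_awalk)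
  then show ?thesis unfolding ddist_def by (rule LeastI_ex)
qed

lemma ddist_le_length: "awalk x p y \<Longrightarrow> ddist G x y \<le> length p"
  unfolding ddist_def by (intro Least_le) blast

lemma ddist_triangle: "ddist G x z \<le> ddist G x y + ddist G y z"
proof -
  obtain p q where pq: "awalk x p y" "length p = ddist G x y" "awalk y q z" "length q = ddist G y z"
    using ex_awalk_ddist[of x y] ex_awalk_ddist[of y z] by blast
  then have "awalk x (p @ q) z" by (intro awalk_appendI)
  from ddist_le_length[OF this] show ?thesis using pq by simp
qed

text \<open>Remove the last arc of a shortest walk; the triangle inequality makes both distance
  bounds sharp.\<close>

lemma ddist_Suc_obtain:
  assumes "ddist G x y = Suc n"
  obtains z where "ddist G x z = n" "ddist G z y = 1"
proof -
  obtain p where p: "awalk x p y" "length p = Suc n" using ex_awalk_ddist assms by metis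
  then obtain q e where q: "p = q @ [e]" by (metis length_Suc_conv_rev)
  then obtain z where z: "awalk x q z" "awalk z [e] y" using p(1) by (auto simp: awalk_append_iff)
  have "ddist G x z \<le> n" "ddist G z y \<le> 1" using z[THEN ddist_le_length] p(2) q by simp_all
  moreover have "Suc n \<le> ddist G x z + ddist G z y" using ddist_triangle[of x y z] assms by simp
  ultimately have "ddist G x z = n" "ddist G z y = 1" by simp_all
  then show thesis by (rule that)
qed

lemma ddiameter_eq: "ddiameter G = Max (range (case_prod (ddist G)))"
  unfolding ddiameter_def by (rule arg_cong[of _ _ Max]) (auto simp: vertices)

lemma ddist_le_ddiameter: "ddist G x y \<le> ddiameter G"
  unfolding ddiameter_eq by (rule Max_ge) auto

text \<open>Descend from the diameter, each time dropping the last arc of a shortest walk.\<close>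

lemma ex_ddist_eq:
  assumes "h \<le> ddiameter G"
  shows "\<exists>x y. ddist G x y = h"
  using assms
proof (induction rule: inc_induct)
  case base
  have "ddiameter G \<in> range (case_prod (ddist G))" unfolding ddiameter_eq by (rule Max_in) auto
  then show ?case by (metis (no_types, lifting) case_prod_conv imageE surj_pair)
next
  case (step n)
  then show ?case by (metis ddist_Suc_obtain)
qed

section \<open>Expansions and products of distance matrices\<close>

text \<open>Exactly one term survives, and its index is in range because no distance exceeds the
  diameter.\<close>

lemma distance_expansion_nth:
  "(\<Sum>h=0..ddiameter G. c h *\<^sub>M distance_matrix G h) $ x $ y = c (ddist G x y)"
proof -
  have "(\<Sum>h=0..ddiameter G. c h *\<^sub>M distance_matrix G h) $ x $ y
      = (\<Sum>h=0..ddiameter G. if ddist G x y = h then c h else 0)"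
    by (simp add: matrix_scale_def distance_matrix_def if_distrib cong: if_cong)
  also have "\<dots> = c (ddist G x y)" using ddist_le_ddiameter[of x y] by simp
  finally show ?thesis .
qed

lemma distance_expansion_iff:
  "M = (\<Sum>h=0..ddiameter G. c h *\<^sub>M distance_matrix G h)
     \<longleftrightarrow> (\<forall>x y. M $ x $ y = c (ddist G x y))"
  by (simp only: vec_eq_iff distance_expansion_nth)

lemma distance_matrix_mult_nth:
  "(distance_matrix G i ** distance_matrix G j) $ x $ y
     = of_nat (card (out_sphere G i x \<inter> in_sphere G j y))"
proof -
  have "out_sphere G i x \<inter> in_sphere G j y = {z. ddist G x z = i \<and> ddist G z y = j}"
    by (auto simp: out_sphere_def in_sphere_def vertices)
  moreover have "(distance_matrix G i ** distance_matrix G j) $ x $ y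
      = (\<Sum>z\<in>UNIV. if ddist G x z = i \<and> ddist G z y = j then 1 else 0)"
    unfolding matrix_matrix_mult_def
    by (auto simp: distance_matrix_def intro!: sum.cong)
  ultimately show ?thesis by (simp add: sum.If_cases)
qed

lemma distance_matrix_mult_transpose_nth:
  "(distance_matrix G i ** transpose (distance_matrix G j)) $ x $ y
     = of_nat (card (out_sphere G i x \<inter> out_sphere G j y))"
proof -
  have "out_sphere G i x \<inter> out_sphere G j y = {z. ddist G x z = i \<and> ddist G y z = j}"
    by (auto simp: out_sphere_def vertices)
  moreover have "(distance_matrix G i ** transpose (distance_matrix G j)) $ x $ y
      = (\<Sum>z\<in>UNIV. if ddist G x z = i \<and> ddist G y z = j then 1 else 0)"
    unfolding matrix_matrix_mult_def
    by (auto simp: distance_matrix_def transpose_def intro!: sum.cong)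
  ultimately show ?thesis by (simp add: sum.If_cases)
qed

lemma adjacency_eq_distance_matrix: "adjacency_matrix G = distance_matrix G 1"
  using distance_matrix_1[OF strong _ vertices] loopfree_digraph_axioms by simp

section \<open>Distance-regularity and closure under multiplication\<close>

text \<open>Entry \<open>(x, y)\<close> of A_j A counts the in-neighbours of \<open>y\<close> in the
  out-sphere of radius \<open>j\<close> about \<open>x\<close>; A_j A^T counts the
  out-neighbours.\<close>

lemma distance_regular_iff:
  "distance_regular_digraph G \<longleftrightarrow>
     (\<forall>j\<le>ddiameter G. distance_invariant G (distance_matrix G j ** adjacency_matrix G) \<and>
        distance_invariant G (distance_matrix G j ** transpose (adjacency_matrix G)))"
  (is "_ \<longleftrightarrow> ?R")
proof
  assume "distance_regular_digraph G"
  then obtain dout din :: "nat \<Rightarrow> nat \<Rightarrow> int" where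
    d: "\<And>i j x y. i \<le> ddiameter G \<Longrightarrow> j \<le> ddiameter G \<Longrightarrow> y \<in> out_sphere G i x \<Longrightarrow>
      int (card (out_sphere G 1 y \<inter> out_sphere G j x)) = dout i j \<and>
      int (card (in_sphere G 1 y \<inter> out_sphere G j x)) = din i j"
    unfolding distance_regular_digraph_def vertices by blast
  have d: "int (card (out_sphere G j x \<inter> out_sphere G 1 y)) = dout (ddist G x y) j"
    "int (card (out_sphere G j x \<inter> in_sphere G 1 y)) = din (ddist G x y) j"
    if "j \<le> ddiameter G" for j x y
  proof -
    have "y \<in> out_sphere G (ddist G x y) x" by (simp add: out_sphere_def vertices)
    from d[OF ddist_le_ddiameter that this]
    show "int (card (out_sphere G j x \<inter> out_sphere G 1 y)) = dout (ddist G x y) j"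
      "int (card (out_sphere G j x \<inter> in_sphere G 1 y)) = din (ddist G x y) j"
      by (simp_all only: Int_commute)
  qed
  show ?R
    unfolding distance_invariant_def adjacency_eq_distance_matrix
      distance_matrix_mult_nth distance_matrix_mult_transpose_nth
  proof (intro allI impI conjI)
    fix j assume j: "j \<le> ddiameter G"
    show "\<exists>c. \<forall>x y. (of_nat (card (out_sphere G j x \<inter> in_sphere G 1 y)) :: complex)
      = c (ddist G x y)"
      using d(2)[OF j] by (intro exI[of _ "\<lambda>h. of_int (din h j)"]) (metis of_int_of_nat_eq)
    show "\<exists>c. \<forall>x y. (of_nat (card (out_sphere G j x \<inter> out_sphere G 1 y)) :: complex)
      = c (ddist G x y)"
      using d(1)[OF j] by (intro exI[of _ "\<lambda>h. of_int (dout h j)"]) (metis of_int_of_nat_eq)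
  qed
next
  assume ?R
  then obtain cin cout where
    c: "\<And>j x y. j \<le> ddiameter G \<Longrightarrow>
        of_nat (card (out_sphere G j x \<inter> in_sphere G 1 y)) = (cin j (ddist G x y) :: complex)"
      "\<And>j x y. j \<le> ddiameter G \<Longrightarrow>
        of_nat (card (out_sphere G j x \<inter> out_sphere G 1 y)) = (cout j (ddist G x y) :: complex)"
    unfolding distance_invariant_def adjacency_eq_distance_matrix
      distance_matrix_mult_nth distance_matrix_mult_transpose_nth by metis
  \<comment> \<open>The parameters must be integers: each coefficient that is attained is a
    cardinality, and the floor of its real part returns it as an \<open>int\<close>.\<close>
  have toint: "int n = \<lfloor>Re z\<rfloor>" if "of_nat n = z" for n z
    using that by auto
  show "distance_regular_digraph G"
    unfolding distance_regular_digraph_def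
    by (intro exI[of _ "\<lambda>i j. \<lfloor>Re (cout j i)\<rfloor>"] exI[of _ "\<lambda>i j. \<lfloor>Re (cin j i)\<rfloor>"])
      (use c[THEN toint] in \<open>auto simp: out_sphere_def Int_commute\<close>)
qed

text \<open>Expresses that the distance matrices are polynomials in the adjacency matrix.\<close>

lemma distance_matrix_induct:
  assumes inv: "\<And>j. j \<le> ddiameter G \<Longrightarrow>
      distance_invariant G (distance_matrix G j ** adjacency_matrix G)"
    and one: "P (mat 1)"
    and add: "\<And>M N. P M \<Longrightarrow> P N \<Longrightarrow> P (M + N)"
    and scale: "\<And>a M. P M \<Longrightarrow> P (a *\<^sub>M M)"
    and mult: "\<And>M. P M \<Longrightarrow> P (M ** adjacency_matrix G)"
    and i: "i \<le> ddiameter G"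
  shows "P (distance_matrix G i)"
  using i
proof (induction i rule: less_induct)
  case (less i)
  show ?case
  proof (cases i)
    case 0
    then show ?thesis using one distance_matrix_0[OF strong _ vertices] wf_digraph_axioms by simp
  next
    case (Suc j)
    let ?B = "distance_matrix G j ** adjacency_matrix G"
    have B_nth: "?B $ x $ y = of_nat (card (out_sphere G j x \<inter> in_sphere G 1 y))" for x y
      by (simp only: adjacency_eq_distance_matrix distance_matrix_mult_nth)
    obtain c where c: "\<And>x y. ?B $ x $ y = c (ddist G x y)"
      using inv[of j] less.prems Suc by (auto simp: distance_invariant_def)
    \<comment> \<open>One arc after a vertex at distance \<open>j\<close> from \<open>x\<close>
      reaches distance at most \<open>i\<close>, so nothing is counted.\<close>
    have zero: "c (ddist G x y) = 0" if "ddist G x y > i" for x y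
    proof -
      have "out_sphere G j x \<inter> in_sphere G 1 y = {}"
      proof (rule equals0I)
        fix z assume "z \<in> out_sphere G j x \<inter> in_sphere G 1 y"
        then show False
          using that Suc ddist_triangle[of x y z] by (simp add: out_sphere_def in_sphere_def)
      qed
      then show ?thesis using c B_nth by (metis card.empty of_nat_0)
    qed
    \<comment> \<open>The second-to-last vertex of a shortest walk of length \<open>i\<close> is
      counted.\<close>
    have nz: "c i \<noteq> 0"
    proof -
      obtain x y where xy: "ddist G x y = i" using ex_ddist_eq less.prems by blast
      then obtain z where "ddist G x z = j" "ddist G z y = 1" using ddist_Suc_obtain Suc by metis
      then have "z \<in> out_sphere G j x \<inter> in_sphere G 1 y"
        by (simp add: out_sphere_def in_sphere_def vertices)
      then have "card (out_sphere G j x \<inter> in_sphere G 1 y) \<noteq> 0" by (metis card_0_eq empty_iff finite)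
      then show ?thesis using c B_nth xy by (metis of_nat_eq_0_iff)
    qed
    have Psum: "P (\<Sum>h\<in>S. a h *\<^sub>M distance_matrix G h)" if "finite S" "S \<subseteq> {..<i}" for S a
      using that
    proof (induction S rule: finite_induct)
      case empty
      \<comment> \<open>The empty sum needs \<open>P 0\<close>, which comes from scaling the
        identity by zero.\<close>
      have "0 *\<^sub>M mat 1 = (0 :: complex^'v^'v)" by (simp add: matrix_scale_def vec_eq_iff)
      then show ?case using scale[OF one, of 0] by simp
    next
      case (insert h S)
      then show ?case using less.IH[of h] less.prems by (simp add: add scale)
    qed
    \<comment> \<open>By \<open>zero\<close>, \<open>?B\<close> is a combination of the A_h with h
      \<le> i; this is solved for A_i.\<close>
    have eq: "distance_matrix G i
        = (1 / c i) *\<^sub>M (?B + (\<Sum>h<i. (- c h) *\<^sub>M distance_matrix G h))"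
      (is "_ = ?rhs")
    proof -
      have "distance_matrix G i $ x $ y = ?rhs $ x $ y" for x y
      proof -
        have "(\<Sum>h<i. (- c h) *\<^sub>M distance_matrix G h) $ x $ y
            = (\<Sum>h<i. if ddist G x y = h then - c h else 0)"
          by (simp add: matrix_scale_def distance_matrix_def if_distrib cong: if_cong)
        also have "\<dots> = (if ddist G x y < i then - c (ddist G x y) else 0)" by simp
        finally have "?rhs $ x $ y
            = (1 / c i) * (c (ddist G x y) + (if ddist G x y < i then - c (ddist G x y) else 0))"
          by (simp add: c matrix_scale_def)
        then show ?thesis
          using nz zero[of x y] by (cases "ddist G x y" i rule: linorder_cases)
            (simp_all add: distance_matrix_def)
      qed
      then show ?thesis unfolding vec_eq_iff by blast
    qed
    have "P ?B" using less.IH[of j] less.prems Suc mult by simp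
    then show ?thesis unfolding eq by (rule scale[OF add]) (rule Psum, simp_all)
  qed
qed

text \<open>Expanding \<open>M\<close> settles the right factors A and A^T; since the A_i are
  polynomials in A, induction extends this to them and their transposes.\<close>

lemma distance_regular_mult:
  assumes reg: "distance_regular_digraph G"
    and M: "distance_invariant G M"
    and i: "i \<le> ddiameter G"
  shows "distance_invariant G (M ** distance_matrix G i)"
    and "distance_invariant G (M ** transpose (distance_matrix G i))"
proof -
  let ?A = "adjacency_matrix G"
  have closed: "distance_invariant G (M ** N)"
    if M: "distance_invariant G M"
      and N: "\<And>j. j \<le> ddiameter G \<Longrightarrow> distance_invariant G (distance_matrix G j ** N)" for M N
  proof -
    obtain c where "M = (\<Sum>h=0..ddiameter G. c h *\<^sub>M distance_matrix G h)"
      using M unfolding distance_invariant_def distance_expansion_iff by blast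
    then show ?thesis
      by (auto simp: sum_matrix_mult matrix_mult_scale_left
          intro!: distance_invariant_sum distance_invariant_scale N)
  qed
  have A: "distance_invariant G (M ** ?A)" "distance_invariant G (M ** transpose ?A)"
    if "distance_invariant G M" for M
    using reg closed[OF that] by (auto simp: distance_regular_iff)
  \<comment> \<open>\<open>P\<close> quantifies over all left factors because K (M A)^T = (K A^T)
    M^T calls for the hypothesis on M with left factor K A^T.\<close>
  define P where "P N \<longleftrightarrow> (\<forall>M. distance_invariant G M \<longrightarrow>
    distance_invariant G (M ** N) \<and> distance_invariant G (M ** transpose N))" for N
  have "P (distance_matrix G i)"
  proof (rule distance_matrix_induct[OF _ _ _ _ _ i])
    show "distance_invariant G (distance_matrix G j ** ?A)" for j
      by (rule A(1)[OF distance_invariant_distance_matrix])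
    show "P (mat 1)" by (simp add: P_def transpose_mat)
    show "P (M + N)" if "P M" "P N" for M N
      using that by (simp add: P_def transpose_add matrix_add_ldistrib distance_invariant_add)
    show "P (a *\<^sub>M M)" if "P M" for a M
      using that
      by (simp add: P_def transpose_scale matrix_mult_scale_right distance_invariant_scale)
    show "P (M ** ?A)" if "P M" for M
      using that A by (simp add: P_def matrix_transpose_mul matrix_mul_assoc)
  qed
  then show "distance_invariant G (M ** distance_matrix G i)"
    and "distance_invariant G (M ** transpose (distance_matrix G i))"
    using M by (simp_all add: P_def)
qed

text \<open>Multiplying the identity by A_i^T puts A_i^T in the span, so a distance determines the
  reverse distance.\<close>

lemma distance_regular_transpose:
  assumes reg: "distance_regular_digraph G" and i: "i \<le> ddiameter G"
  shows "transpose (distance_matrix G i) \<in> distance_matrix G ` {0..ddiameter G}"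
proof -
  have one: "distance_invariant G (mat 1)"
    using distance_invariant_distance_matrix[of G 0]
      distance_matrix_0[OF strong _ vertices] wf_digraph_axioms by simp
  have rev: "ddist G y x = ddist G y' x'" if "ddist G x y = ddist G x' y'" for x y x' y'
  proof -
    \<comment> \<open>This index makes the entry at \<open>(x, y)\<close> equal to 1, hence also the
      entry at \<open>(x', y')\<close>.\<close>
    have "distance_invariant G (transpose (distance_matrix G (ddist G y x)))"
      using distance_regular_mult(2)[OF reg one ddist_le_ddiameter[of y x]] by simp
    then have "transpose (distance_matrix G (ddist G y x)) $ x' $ y'
        = transpose (distance_matrix G (ddist G y x)) $ x $ y"
      using that by (auto simp: distance_invariant_def)
    then show ?thesis by (simp add: transpose_def distance_matrix_def split: if_splits)
  qed
  \<comment> \<open>Reversing any one pair at distance \<open>i\<close> yields the index of the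
    transpose.\<close>
  obtain x0 y0 where "ddist G x0 y0 = i" using ex_ddist_eq i by blast
  then have "ddist G y x = i \<longleftrightarrow> ddist G x y = ddist G y0 x0" for x y
    using rev by metis
  then have "transpose (distance_matrix G i) = distance_matrix G (ddist G y0 x0)"
    by (simp add: transpose_def distance_matrix_def vec_eq_iff)
  then show ?thesis using ddist_le_ddiameter by auto
qed

text \<open>If A^T = A_k, then A_j A^T = A_j A_k lies in the span. The first premise is conditional
  since a single vertex gives A = 0, which differs from A_0 = I.\<close>

lemma distance_regular_if_closed:
  assumes "ddiameter G \<noteq> 0 \<Longrightarrow>
      transpose (adjacency_matrix G) \<in> distance_matrix G ` {0..ddiameter G}"
    and "\<And>i j. i \<le> ddiameter G \<Longrightarrow> j \<le> ddiameter G \<Longrightarrow>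
      distance_invariant G (distance_matrix G i ** distance_matrix G j)"
  shows "distance_regular_digraph G"
proof (cases "ddiameter G = 0")
  case True
  have "adjacency_matrix G = 0"
    using True ddist_le_ddiameter
    by (simp add: adjacency_eq_distance_matrix distance_matrix_def vec_eq_iff)
  then have "transpose (adjacency_matrix G) = 0" "adjacency_matrix G = 0"
    by (simp_all add: transpose_def vec_eq_iff)
  moreover have "distance_invariant G 0" by (auto simp: distance_invariant_def)
  ultimately show ?thesis by (simp add: distance_regular_iff)
next
  case False
  then show ?thesis
    using assms unfolding distance_regular_iff
    by (auto simp: adjacency_eq_distance_matrix)
qed

end

section \<open>The equivalence with the three conditions on products and transposes\<close>

theorem theorem6p4:
  fixes G :: "('v::finite, 'e) pre_digraph"
    and D :: nat
    and A :: "complex^'v^'v"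
    and Ad :: "nat \<Rightarrow> complex^'v^'v"
  assumes simple: "digraph G"
    and strong: "strongly_connected G"
    and vertices: "verts G = UNIV"
    and D_def: "D = ddiameter G"
    and A_def: "A = adjacency_matrix G"
    and Ad_def: "Ad = distance_matrix G"
  shows "distance_regular_digraph G \<longleftrightarrow>
     (transpose A \<in> Ad ` {0..D} \<and>
      (\<exists>p :: nat \<Rightarrow> nat \<Rightarrow> nat \<Rightarrow> complex.
         \<forall>i\<le>D. \<forall>j\<le>D. Ad i ** Ad j = (\<Sum>h=0..D. p h i j *\<^sub>M Ad h)))
   \<or> ((\<forall>i\<le>D. transpose (Ad i) \<in> Ad ` {0..D}) \<and>
      (\<exists>p :: nat \<Rightarrow> nat \<Rightarrow> nat \<Rightarrow> complex.
         \<forall>i\<le>D. \<forall>j\<le>D. Ad i ** Ad j = (\<Sum>h=0..D. p h i j *\<^sub>M Ad h)))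
   \<or> (transpose A \<in> Ad ` {0..D} \<and>
      (\<exists>p :: nat \<Rightarrow> nat \<Rightarrow> nat \<Rightarrow> complex.
         \<forall>i\<le>D. \<forall>j\<le>D. \<forall>h\<le>D. \<forall>x\<in>verts G. \<forall>y\<in>out_sphere G h x.
           of_nat (card (out_sphere G i x \<inter> in_sphere G j y)) = p h i j))"
proof -
  note G = simple strong vertices
  \<comment> \<open>The first two conditions share this closure statement; \<open>p h i j\<close> is
    the value of the product at distance \<open>h\<close>.\<close>
  have closed_iff: "(\<exists>p. \<forall>i\<le>D. \<forall>j\<le>D. Ad i ** Ad j = (\<Sum>h=0..D. p h i j *\<^sub>M Ad h))
      \<longleftrightarrow> (\<forall>i\<le>D. \<forall>j\<le>D. distance_invariant G (Ad i ** Ad j))" (is "?L = ?R")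
  proof
    assume ?L
    then show ?R
      by (auto simp: D_def Ad_def
          intro!: distance_invariant_sum distance_invariant_scale distance_invariant_distance_matrix)
  next
    assume ?R
    then obtain c where "\<And>i j x y. i \<le> D \<Longrightarrow> j \<le> D \<Longrightarrow> (Ad i ** Ad j) $ x $ y = c i j (ddist G x y)"
      unfolding distance_invariant_def by metis
    then show ?L
      unfolding D_def Ad_def distance_expansion_iff[OF G]
      by (intro exI[of _ "\<lambda>h i j. c i j h"]) simp
  qed
  have reg_if: "distance_regular_digraph G"
    if "D \<noteq> 0 \<Longrightarrow> transpose A \<in> Ad ` {0..D}"
      and "\<forall>i\<le>D. \<forall>j\<le>D. distance_invariant G (Ad i ** Ad j)"
    using distance_regular_if_closed[OF G] that by (simp add: D_def A_def Ad_def)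
  show ?thesis
    unfolding closed_iff
  proof (intro iffI; (elim disjE conjE)?)
    assume "distance_regular_digraph G"
    \<comment> \<open>The second alternative is the one to establish: with a single vertex it still
      holds, while the other two fail.\<close>
    then have "\<forall>i\<le>D. transpose (Ad i) \<in> Ad ` {0..D}"
      and "\<forall>i\<le>D. \<forall>j\<le>D. distance_invariant G (Ad i ** Ad j)"
      using distance_regular_transpose[OF G] distance_regular_mult(1)[OF G]
        distance_invariant_distance_matrix[of G]
      unfolding D_def Ad_def by blast+
    then show "transpose A \<in> Ad ` {0..D} \<and> (\<forall>i\<le>D. \<forall>j\<le>D. distance_invariant G (Ad i ** Ad j))
      \<or> (\<forall>i\<le>D. transpose (Ad i) \<in> Ad ` {0..D}) \<and> (\<forall>i\<le>D. \<forall>j\<le>D. distance_invariant G (Ad i ** Ad j))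
      \<or> transpose A \<in> Ad ` {0..D} \<and>
        (\<exists>p :: nat \<Rightarrow> nat \<Rightarrow> nat \<Rightarrow> complex.
          \<forall>i\<le>D. \<forall>j\<le>D. \<forall>h\<le>D. \<forall>x\<in>verts G. \<forall>y\<in>out_sphere G h x.
            of_nat (card (out_sphere G i x \<inter> in_sphere G j y)) = p h i j)"
      by blast
  next
    assume "transpose A \<in> Ad ` {0..D}" "\<forall>i\<le>D. \<forall>j\<le>D. distance_invariant G (Ad i ** Ad j)"
    then show "distance_regular_digraph G" by (intro reg_if)
  next
    assume tr: "\<forall>i\<le>D. transpose (Ad i) \<in> Ad ` {0..D}"
      and "\<forall>i\<le>D. \<forall>j\<le>D. distance_invariant G (Ad i ** Ad j)"
    \<comment> \<open>A nonzero diameter brings the index 1 of A into range.\<close>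
    moreover have "transpose A \<in> Ad ` {0..D}" if "D \<noteq> 0"
      using tr that by (simp add: A_def Ad_def adjacency_eq_distance_matrix[OF G])
    ultimately show "distance_regular_digraph G" by (intro reg_if)
  next
    assume tr: "transpose A \<in> Ad ` {0..D}"
      and "\<exists>p :: nat \<Rightarrow> nat \<Rightarrow> nat \<Rightarrow> complex.
          \<forall>i\<le>D. \<forall>j\<le>D. \<forall>h\<le>D. \<forall>x\<in>verts G. \<forall>y\<in>out_sphere G h x.
            of_nat (card (out_sphere G i x \<inter> in_sphere G j y)) = p h i j"
    then obtain p :: "nat \<Rightarrow> nat \<Rightarrow> nat \<Rightarrow> complex" where
      p: "\<And>i j h x y. i \<le> D \<Longrightarrow> j \<le> D \<Longrightarrow> h \<le> D \<Longrightarrow> y \<in> out_sphere G h x \<Longrightarrow>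
        of_nat (card (out_sphere G i x \<inter> in_sphere G j y)) = p h i j"
      unfolding vertices by blast
    \<comment> \<open>The cardinality is an entry of A_i A_j, and every pair of vertices is at some
      distance h \<le> D, so \<open>p\<close> covers the whole matrix.\<close>
    have "distance_invariant G (Ad i ** Ad j)" if "i \<le> D" "j \<le> D" for i j
      unfolding distance_invariant_def Ad_def distance_matrix_mult_nth[OF G]
      using p[OF that] ddist_le_ddiameter[OF G]
      by (intro exI[of _ "\<lambda>h. p h i j"]) (simp add: out_sphere_def vertices D_def)
    with tr show "distance_regular_digraph G" by (intro reg_if) simp_all
  qed
qed

end
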